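(* Let $0 < a < \ln 2$. Then $$M(a) = \frac{\gamma}{a} + \frac{a + \ln(1-e^{-a}) - \gamma - \ln a}{1-e^{-a}} + \frac{a}{1-e^{-a}} \int_{0}^{1} e^{-at} \ln \Gamma(t)\, dt .$$
   Context: For real $a$, $$M(a) := \frac{4}{\pi}\int_0^{\pi/2} \frac{x^2\,dx}{x^2+\ln^2(2e^{-a}\cos x)},$$ where $\ln^2(y)=(\ln y)^2$. Here $\gamma=\lim_{n\to\infty}\left(\sum_{k=1}^n \frac1k-\ln n\right)$ is Euler's constant and $\Gamma$ is the gamma function. *)

theory Defs
  imports "HOL-Analysis.Analysis"
begin

text \<open>
  At the endpoint \<open>x = pi/2\<close> the library convention \<open>ln 0 = 0\<close> applies; this single point
  does not affect the integral.
\<close>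

definition M :: "real \<Rightarrow> real" where
  "M a = 4 / pi * integral {0..pi/2} (\<lambda>x. x\<^sup>2 / (x\<^sup>2 + (ln (2 * exp (- a) * cos x))\<^sup>2))"

end

theory Submission
  imports Defs "HOL-Complex_Analysis.Complex_Analysis" "HOL-Real_Asymp.Real_Asymp"
begin

text \<open>
  Let \<open>f z = 1 / (Ln (1 + z) - a)\<close>. On the unit circle
  \<open>Ln (1 + cis \<theta>) = ln (2 * cos (\<theta> / 2)) + \<i> * \<theta> / 2\<close>, so after the substitution \<open>\<theta> = 2 * x\<close> the
  integral \<open>M a\<close> becomes \<open>- 1 / \<pi>\<close> times the integral of \<open>\<theta> * Im (f (cis \<theta>))\<close> over \<open>(0, \<pi>)\<close>.

  If \<open>g\<close> is holomorphic in a disc around \<open>0\<close> and real on its real diameter, then integration by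
  parts along the half circle of radius \<open>r\<close> trades the weight \<open>\<theta>\<close> for an integral along a radius:
  \<open>- 1 / \<pi>\<close> times the integral of \<open>\<theta> * Im (g (r * cis \<theta>))\<close> equals the integral of
  \<open>(g (- u) - g 0) / u\<close> over \<open>[0, r]\<close> (\<open>half_circle_integral\<close>). Since \<open>0 < a < ln 2\<close>, the function \<open>f\<close>
  has exactly one singularity in the unit disc, a simple pole at \<open>e\<^sup>a - 1\<close> with residue \<open>e\<^sup>a\<close>.
  On the circle of radius \<open>r\<close> the principal part has the same imaginary part as minus its complex
  conjugate, which continues to a function with its pole outside the circle. This replacement
  makes the lemma applicable and produces the explicit logarithmic term of
  \<open>circle_integral_reciprocal_log\<close>. As \<open>f\<close> is bounded near the unit circle, dominated convergence
  permits \<open>r \<rightarrow> 1\<close>, and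
  \<open>M a = J + (a + ln (1 - e\<^sup>-\<^sup>a)) / (1 - e\<^sup>-\<^sup>a)\<close>, where \<open>J\<close> is the integral of
  \<open>(1 / a - 1 / (a - ln (1 - u))) / u\<close> over \<open>[0, 1]\<close> (\<open>M_eq_unit_interval_integral\<close>).

  To find \<open>J\<close>, put \<open>x = 1 - u\<close> and write \<open>1 / a - 1 / (a - ln x)\<close> as the integral of
  \<open>e\<^sup>-\<^sup>a\<^sup>t * (1 - x powr t)\<close> over \<open>t > 0\<close>. The integral of \<open>(1 - x powr t) / (1 - x)\<close> over \<open>(0, 1)\<close> is
  \<open>Digamma (t + 1) + \<gamma>\<close>, so by Tonelli's theorem \<open>J\<close> is the Laplace transform of
  \<open>Digamma (t + 1) + \<gamma>\<close> at \<open>a\<close> (\<open>nn_integral_Laplace_Digamma\<close>). Integration by parts turns this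
  into the Laplace transform of \<open>ln (Gamma (t + 1))\<close>. The functional equation
  \<open>Gamma (t + 1) = t * Gamma t\<close> and the translation \<open>t \<mapsto> t + 1\<close> finally express that transform by
  the integral of \<open>e\<^sup>-\<^sup>a\<^sup>t * ln (Gamma t)\<close> over \<open>[0, 1]\<close> and the Laplace transform of \<open>ln\<close>
  (\<open>Laplace_ln_Gamma_unit_interval\<close>), the latter being the derivative at \<open>s = 0\<close> of
  \<open>Gamma (1 + s) / a powr (1 + s)\<close>.
\<close>

section \<open>Holomorphic functions that are real on the real axis\<close>

text \<open>The second condition says that \<open>g\<close> commutes with conjugation. It survives difference quotients
  and primitives, and it makes the boundary terms of the integrations by parts real.\<close>

definition real_holomorphic :: "real \<Rightarrow> (complex \<Rightarrow> complex) \<Rightarrow> bool" where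
  "real_holomorphic R g \<longleftrightarrow>
     g holomorphic_on ball 0 R \<and> (\<forall>x::real. \<bar>x\<bar> < R \<longrightarrow> g (of_real x) \<in> \<real>)"

text \<open>The derivative is also the limit of difference quotients along the real axis, and the real
  numbers are closed in the complex plane.\<close>

lemma real_holomorphic_deriv:
  assumes g: "real_holomorphic R g" and c: "\<bar>c\<bar> < R"
  shows "deriv g (of_real c) \<in> \<real>"
proof -
  have "(g has_field_derivative deriv g (of_real c)) (at (of_real c))"
    using g c by (intro holomorphic_derivI[of _ "ball 0 R"]) (auto simp: real_holomorphic_def)
  then have "((\<lambda>h. (g (of_real c + h) - g (of_real c)) / h) \<longlongrightarrow> deriv g (of_real c)) (at 0)"
    by (simp add: DERIV_def)
  moreover have "filterlim complex_of_real (at 0) (at 0)"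
    by (rule filterlim_atI) (auto intro!: tendsto_eq_intros eventually_neq_at_within)
  ultimately have "((\<lambda>h. (g (of_real c + of_real h) - g (of_real c)) / of_real h)
        \<longlongrightarrow> deriv g (of_real c)) (at (0::real))"
    by (rule filterlim_compose)
  moreover have "\<forall>\<^sub>F h in at (0::real). (g (of_real c + of_real h) - g (of_real c)) / of_real h \<in> \<real>"
  proof -
    have "\<forall>\<^sub>F h in at (0::real). \<bar>h\<bar> < R - \<bar>c\<bar>"
      using c by (auto simp: eventually_at intro!: exI[of _ "R - \<bar>c\<bar>"])
    then show ?thesis
    proof eventually_elim
      case (elim h)
      then have "\<bar>c + h\<bar> < R" by linarith
      then have "g (of_real (c + h)) \<in> \<real>" "g (of_real c) \<in> \<real>"
        using g c unfolding real_holomorphic_def by blast+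
      then show ?case by (metis Reals_diff Reals_divide Reals_of_real of_real_add)
    qed
  qed
  ultimately show ?thesis
    by (intro Lim_in_closed_set[OF closed_complex_Reals, rotated 2]) auto
qed

text \<open>Dividing \<open>g z - g c\<close> by \<open>z - c\<close> is needed both at \<open>c = 0\<close>, to integrate \<open>(g z - g 0) / z\<close>,
  and at the pole of \<open>1 / (Ln (1 + z) - a)\<close>, to split off its principal part.\<close>

lemma real_holomorphic_difference_quotient:
  assumes g: "real_holomorphic R g" and c: "\<bar>c\<bar> < R"
  shows "real_holomorphic R (\<lambda>z. if z = of_real c then deriv g (of_real c)
                                   else (g z - g (of_real c)) / (z - of_real c))"
proof -
  have "(\<lambda>z. if z = of_real c then deriv g (of_real c)
              else (g z - g (of_real c)) / (z - of_real c)) holomorphic_on ball 0 R"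
    using g by (intro pole_lemma_open) (auto simp: real_holomorphic_def)
  then show ?thesis
    using g c real_holomorphic_deriv[OF g c]
    unfolding real_holomorphic_def by (auto intro!: Reals_divide Reals_diff)
qed

text \<open>Along the real axis the imaginary part of the primitive has derivative \<open>Im h = 0\<close>, hence it keeps
  its value \<open>0\<close> at the origin.\<close>

lemma real_holomorphic_primitive:
  assumes h: "real_holomorphic R h"
  obtains H where "real_holomorphic R H" "H 0 = 0"
    "\<And>z. norm z < R \<Longrightarrow> (H has_field_derivative h z) (at z)"
proof -
  obtain H0 where H0: "\<And>z. z \<in> ball 0 R \<Longrightarrow> (H0 has_field_derivative h z) (at z within ball 0 R)"
    using holomorphic_convex_primitive'[of "ball 0 R" h] h unfolding real_holomorphic_def by auto
  define H where "H = (\<lambda>z. H0 z - H0 0)"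
  have H: "(H has_field_derivative h z) (at z)" if "norm z < R" for z
    unfolding H_def using H0[of z] that
    by (auto simp: at_within_open[of _ "ball 0 R"] intro!: derivative_eq_intros)
  have "H (of_real x) \<in> \<real>" if x: "\<bar>x\<bar> < R" for x :: real
  proof -
    have d: "((\<lambda>t. Im (H (of_real t))) has_real_derivative 0) (at t)" if t: "\<bar>t\<bar> < R" for t :: real
    proof -
      have "((\<lambda>t. H (of_real t)) has_vector_derivative 1 * h (of_real t)) (at t)"
        using field_vector_diff_chain_at[of complex_of_real 1 t H "h (of_real t)"] H[of "of_real t"] t
          has_vector_derivative_of_real[of "\<lambda>x. x" 1 "at t"]
        by (simp add: o_def)
      from bounded_linear.has_vector_derivative[OF bounded_linear_Im this] show ?thesis
        using h t by (auto simp: real_holomorphic_def complex_is_Real_iff has_real_derivative_iff_has_vector_derivative)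
    qed
    have "\<exists>c. \<forall>t\<in>ball 0 R. Im (H (of_real t)) = c"
    proof (rule has_field_derivative_zero_constant)
      show "((\<lambda>t. Im (H (of_real t))) has_real_derivative 0) (at t within ball 0 R)"
        if "t \<in> ball 0 R" for t :: real
        using d[of t] that by (simp add: has_field_derivative_at_within)
    qed simp
    then obtain c where "\<forall>t\<in>ball 0 R. Im (H (of_real t)) = c"
      by (rule exE)
    from bspec[OF this, of x] bspec[OF this, of 0] have "Im (H (of_real x)) = Im (H (of_real 0))"
      using x by auto
    then show ?thesis by (simp add: complex_is_Real_iff H_def)
  qed
  moreover have "H holomorphic_on ball 0 R"
    using H by (intro holomorphic_onI) (auto simp: field_differentiable_def intro: has_field_derivative_at_within)
  ultimately show ?thesis
    using that[of H] H by (auto simp: real_holomorphic_def H_def)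
qed

text \<open>Let \<open>H\<close> be the primitive of \<open>(g z - g 0) / z\<close> with \<open>H 0 = 0\<close>. Along the arc \<open>z = r * cis \<theta>\<close> the
  derivative of \<open>H\<close> with respect to \<open>\<theta>\<close> is \<open>\<i> * (g z - g 0)\<close>, so integration by parts leaves the
  boundary term \<open>\<pi> * H (- r)\<close> and the integral of \<open>H\<close> over the arc. The real part of the latter
  vanishes: if \<open>P\<close> is a primitive of \<open>H z / z\<close>, the integral is \<open>- \<i> * (P (- r) - P r)\<close>, and \<open>P\<close> is
  real at \<open>\<plusminus>r\<close>. The same \<open>H (- r)\<close> is the integral of \<open>(g (- u) - g 0) / u\<close> along the negative
  radius.\<close>

lemma half_circle_integral:
  assumes g: "real_holomorphic R g" and r: "0 < r" "r < R"
  obtains V where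
    "((\<lambda>\<theta>. \<theta> * Im (g (of_real r * cis \<theta>))) has_integral - pi * V) {0..pi}"
    "((\<lambda>u. (Re (g (of_real (-u))) - Re (g 0)) / u) has_integral V) {0..r}"
proof -
  define h where "h = (\<lambda>z. if z = 0 then deriv g 0 else (g z - g 0) / z)"
  have h: "real_holomorphic R h"
    using real_holomorphic_difference_quotient[OF g, of 0] r
    unfolding h_def of_real_0 diff_0_right by simp
  obtain H where H: "real_holomorphic R H" "H 0 = 0"
      and dH: "\<And>z. norm z < R \<Longrightarrow> (H has_field_derivative h z) (at z)"
    using real_holomorphic_primitive[OF h] by blast
  define k where "k = (\<lambda>z. if z = 0 then deriv H 0 else H z / z)"
  have k: "real_holomorphic R k"
    using real_holomorphic_difference_quotient[OF H(1), of 0] r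
    unfolding k_def of_real_0 diff_0_right H(2) by simp
  obtain P where P: "real_holomorphic R P" 
      and dP: "\<And>z. norm z < R \<Longrightarrow> (P has_field_derivative k z) (at z)"
    using real_holomorphic_primitive[OF k] by blast
  have real: "Im (g (of_real x)) = 0" "Im (P (of_real x)) = 0"
    if "\<bar>x\<bar> < R" for x :: real
    using g P that by (auto simp: real_holomorphic_def complex_is_Real_iff)
  define V where "V = Re (H (of_real (-r)))"
  have circ: "(cis has_vector_derivative \<i> * cis \<theta>) (at \<theta>)" for \<theta>
    by (auto simp: has_vector_derivative_complex_iff intro!: derivative_eq_intros)
  have arc: "((\<lambda>\<theta>. F (of_real r * cis \<theta>)) has_vector_derivative
               (of_real r * (\<i> * cis \<theta>)) * f (of_real r * cis \<theta>)) (at \<theta>)"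
    if "\<And>z. norm z < R \<Longrightarrow> (F has_field_derivative f z) (at z)" for F f \<theta>
  proof -
    have "((\<lambda>\<theta>. of_real r * cis \<theta>) has_vector_derivative of_real r * (\<i> * cis \<theta>)) (at \<theta>)"
      by (intro has_vector_derivative_mult_right circ)
    then show ?thesis
      using field_vector_diff_chain_at[of "\<lambda>\<theta>. of_real r * cis \<theta>" _ \<theta> F] that[of "of_real r * cis \<theta>"] r
      by (auto simp: o_def norm_mult)
  qed
  have ne: "of_real r * cis \<theta> \<noteq> 0" for \<theta> using r by simp
  \<comment> \<open>The antiderivative along the arc that integration by parts produces.\<close>
  define \<Phi> where "\<Phi> = (\<lambda>\<theta>. of_real \<theta> * H (of_real r * cis \<theta>) + \<i> * P (of_real r * cis \<theta>))"
  have "(\<Phi> has_vector_derivative of_real \<theta> * (\<i> * (g (of_real r * cis \<theta>) - g 0))) (at \<theta>)" for \<theta>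
  proof -
    have 1: "((\<lambda>\<theta>. H (of_real r * cis \<theta>)) has_vector_derivative \<i> * (g (of_real r * cis \<theta>) - g 0)) (at \<theta>)"
      using arc[OF dH, of \<theta>] ne[of \<theta>] by (simp add: h_def)
    have 2: "((\<lambda>\<theta>. P (of_real r * cis \<theta>)) has_vector_derivative \<i> * H (of_real r * cis \<theta>)) (at \<theta>)"
      using arc[OF dP, of \<theta>] ne[of \<theta>] by (simp add: k_def)
    have 3: "(complex_of_real has_vector_derivative 1) (at \<theta>)"
      using has_vector_derivative_of_real[of "\<lambda>x. x" 1] by simp
    show ?thesis unfolding \<Phi>_def
      using has_vector_derivative_add[OF has_vector_derivative_mult[OF 3 1]
          has_vector_derivative_mult_right[OF 2, of \<i>]]
      by simp
  qed
  then have "((\<lambda>\<theta>. of_real \<theta> * (\<i> * (g (of_real r * cis \<theta>) - g 0))) has_integral \<Phi> pi - \<Phi> 0) {0..pi}"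
    by (intro fundamental_theorem_of_calculus) (auto intro: has_vector_derivative_at_within)
  from has_integral_linear[OF this bounded_linear_Re]
  have "((\<lambda>\<theta>. - (\<theta> * Im (g (of_real r * cis \<theta>)))) has_integral Re (\<Phi> pi - \<Phi> 0)) {0..pi}"
    using real(1)[of 0] r by (simp add: o_def algebra_simps)
  moreover have "Re (\<Phi> pi - \<Phi> 0) = pi * V"
    using real(2)[of r] real(2)[of "-r"] r by (simp add: \<Phi>_def V_def cis_pi)
  ultimately have 1: "((\<lambda>\<theta>. \<theta> * Im (g (of_real r * cis \<theta>))) has_integral - pi * V) {0..pi}"
    by (simp add: has_integral_neg_iff[where f = "\<lambda>\<theta>. \<theta> * Im (g (of_real r * cis \<theta>))", symmetric])
  have "((\<lambda>u. (Re (g (of_real (-u))) - Re (g 0)) / u) has_integral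
          Re (H (of_real (-r))) - Re (H (of_real (-0)))) {0..r}"
  proof (rule fundamental_theorem_of_calculus_interior)
    have d: "((\<lambda>u. Re (H (of_real (-u)))) has_vector_derivative - Re (h (of_real (-u)))) (at u)"
      if "0 \<le> u" "u \<le> r" for u
    proof -
      have "((\<lambda>u. of_real (-u)) has_vector_derivative complex_of_real (-1)) (at u)"
        by (intro has_vector_derivative_of_real derivative_eq_intros) auto
      then have "((\<lambda>u. H (of_real (-u))) has_vector_derivative of_real (-1) * h (of_real (-u))) (at u)"
        using field_vector_diff_chain_at[of "\<lambda>u. complex_of_real (-u)" "of_real (-1)" u H "h (of_real (-u))"]
          dH[of "of_real (-u)"] that r
        by (simp add: o_def)
      from bounded_linear.has_vector_derivative[OF bounded_linear_Re this] show ?thesis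
        by (simp add: has_real_derivative_iff_has_vector_derivative)
    qed
    show "continuous_on {0..r} (\<lambda>u. Re (H (of_real (-u))))"
      by (intro continuous_at_imp_continuous_on ballI has_vector_derivative_continuous[OF d]) auto
    show "((\<lambda>u. Re (H (of_real (-u)))) has_vector_derivative
            (Re (g (of_real (-u))) - Re (g 0)) / u) (at u)" if "u \<in> {0<..<r}" for u
    proof -
      have "- Re (h (of_real (-u))) = (Re (g (of_real (-u))) - Re (g 0)) / u"
        using that by (simp add: h_def Re_divide_of_real field_simps)
      then show ?thesis using d[of u] that by simp
    qed
  qed (use r in auto)
  then have 2: "((\<lambda>u. (Re (g (of_real (-u))) - Re (g 0)) / u) has_integral V) {0..r}"
    by (simp add: V_def H(2))
  show ?thesis using that 1 2 by blast
qed

section \<open>The reciprocal of the shifted logarithm on circles of radius less than 1\<close>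

lemma exp_minus_1_bounds:
  fixes a :: real
  assumes "0 < a" "a < ln 2"
  shows "0 < exp a - 1" "exp a - 1 < 1"
proof -
  have "exp a < exp (ln 2)" using assms by (subst exp_less_cancel_iff)
  then show "exp a - 1 < 1" by simp
qed (use assms in auto)

lemma one_plus_disc_notin_nonpos_Reals:
  assumes "norm (z::complex) < 1"
  shows "1 + z \<notin> \<real>\<^sub>\<le>\<^sub>0"
proof -
  have "- 1 < Re z" using abs_Re_le_cmod[of z] assms by linarith
  then show ?thesis by (auto simp: complex_nonpos_Reals_iff)
qed

text \<open>The only zero of \<open>Ln (1 + z) - a\<close> in the unit disc is \<open>e\<^sup>a - 1\<close>, and it is simple. Hence
  \<open>q z = (Ln (1 + z) - a) / (z - (e\<^sup>a - 1))\<close> extends to a function without zeros, with value \<open>e\<^sup>-\<^sup>a\<close> at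
  \<open>e\<^sup>a - 1\<close>, and the regular part \<open>g\<close> is the difference quotient of \<open>1 / q\<close> at this point.\<close>

lemma reciprocal_log_principal_part:
  fixes a :: real
  assumes a: "0 < a" "a < ln 2"
  obtains g where "real_holomorphic 1 g"
    "\<And>z. norm z < 1 \<Longrightarrow> z \<noteq> of_real (exp a - 1) \<Longrightarrow>
       1 / (Ln (1 + z) - of_real a) = of_real (exp a) / (z - of_real (exp a - 1)) + g z"
proof -
  define c where "c = exp a - 1"
  have c: "\<bar>c\<bar> < 1" "0 < c" using exp_minus_1_bounds[OF a] by (auto simp: c_def)
  define L where "L = (\<lambda>z. Ln (1 + z))"
  have L: "real_holomorphic 1 L"
    unfolding real_holomorphic_def
  proof (intro conjI allI impI)
    show "L holomorphic_on ball 0 1"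
      unfolding L_def using one_plus_disc_notin_nonpos_Reals by (intro holomorphic_intros) auto
    fix x :: real assume "\<bar>x\<bar> < 1"
    then have "L (of_real x) = of_real (ln (1 + x))"
      using Ln_of_real[of "1 + x"] by (simp add: L_def)
    then show "L (of_real x) \<in> \<real>" by simp
  qed
  have Lc: "L (of_real c) = of_real a"
    using Ln_of_real[of "exp a"] by (simp add: L_def c_def)
  have "(L has_field_derivative inverse (1 + of_real c)) (at (of_real c))"
    unfolding L_def using one_plus_disc_notin_nonpos_Reals[of "of_real c"] c
    by (auto intro!: derivative_eq_intros)
  then have dL: "deriv L (of_real c) = of_real (exp (- a))"
    by (simp add: DERIV_imp_deriv c_def exp_minus of_real_inverse)
  define q where "q = (\<lambda>z. if z = of_real c then deriv L (of_real c)
                            else (L z - L (of_real c)) / (z - of_real c))"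
  have q: "real_holomorphic 1 q"
    unfolding q_def by (rule real_holomorphic_difference_quotient[OF L c(1)])
  have q0: "q z \<noteq> 0" if z: "norm z < 1" for z
  proof (cases "z = of_real c")
    case True
    then show ?thesis by (simp add: q_def dL)
  next
    case False
    have "L z \<noteq> of_real a"
    proof
      assume "L z = of_real a"
      then have "exp (Ln (1 + z)) = of_real (exp a)" by (simp add: L_def exp_of_real)
      moreover have "1 + z \<noteq> 0" using one_plus_disc_notin_nonpos_Reals[OF z] by auto
      ultimately have "1 + z = of_real (exp a)" by simp
      then have "z = of_real c" by (simp add: c_def algebra_simps eq_diff_eq)
      then show False using False by simp
    qed
    then show ?thesis using False by (simp add: q_def Lc)
  qed
  have iq: "real_holomorphic 1 (\<lambda>z. 1 / q z)"
    using q q0 unfolding real_holomorphic_def by (auto intro!: holomorphic_intros Reals_divide)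
  define g where "g = (\<lambda>z. if z = of_real c then deriv (\<lambda>z. 1 / q z) (of_real c)
                            else (1 / q z - 1 / q (of_real c)) / (z - of_real c))"
  have g: "real_holomorphic 1 g"
    unfolding g_def by (rule real_holomorphic_difference_quotient[OF iq c(1)])
  have "1 / (Ln (1 + z) - of_real a) = of_real (exp a) / (z - of_real c) + g z"
    if "norm z < 1" "z \<noteq> of_real c" for z
  proof -
    have "1 / q (of_real c) = of_real (exp a)"
      by (simp add: q_def dL exp_minus inverse_eq_divide)
    then have "g z = (1 / q z) / (z - of_real c) - of_real (exp a) / (z - of_real c)"
      using that by (simp add: g_def diff_divide_distrib)
    moreover have "(1 / q z) / (z - of_real c) = 1 / (Ln (1 + z) - of_real a)"
      using that by (simp add: q_def Lc) (simp add: L_def)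
    ultimately show ?thesis by simp
  qed
  with g show ?thesis using that unfolding c_def by blast
qed

text \<open>The lemma on half circles does not apply to \<open>f z = 1 / (Ln (1 + z) - a)\<close> itself, because \<open>f\<close> has a
  pole at \<open>c = e\<^sup>a - 1\<close> inside the circle. Replacing the principal part \<open>e\<^sup>a / (z - c)\<close> by minus its
  complex conjugate keeps the imaginary part. On the circle \<open>cnj z = r\<^sup>2 / z\<close>, so this conjugate is
  \<open>e\<^sup>a * z / (r\<^sup>2 - c * z)\<close>, whose pole \<open>r\<^sup>2 / c\<close> lies outside. The logarithm in the result is the
  integral along the radius of the difference made by the replacement.\<close>

lemma circle_integral_reciprocal_log:
  fixes a r :: real
  assumes a: "0 < a" "a < ln 2" and r: "exp a - 1 < r" "r < 1"
  obtains W where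
    "((\<lambda>\<theta>. \<theta> * Im (1 / (Ln (1 + of_real r * cis \<theta>) - of_real a))) has_integral
        - pi * (W + ln ((exp a - 1) / r) / (1 - exp (- a)))) {0..pi}"
    "((\<lambda>u. (1 / a - 1 / (a - ln (1 - u))) / u) has_integral W) {0..r}"
proof -
  define c where "c = exp a - 1"
  have c: "0 < c" "c < 1" "c < r" using exp_minus_1_bounds[OF a] r by (auto simp: c_def)
  obtain g where g: "real_holomorphic 1 g"
    and gz: "\<And>z. norm z < 1 \<Longrightarrow> z \<noteq> of_real c \<Longrightarrow>
       1 / (Ln (1 + z) - of_real a) = of_real (exp a) / (z - of_real c) + g z"
    using reciprocal_log_principal_part[OF a] unfolding c_def by metis
  define R where "R = min 1 (r\<^sup>2 / c)"
  have "r < r\<^sup>2 / c" using c by (simp add: field_simps power2_eq_square)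
  then have R: "0 < r" "r < R" using c r by (auto simp: R_def)
  have den: "of_real (r\<^sup>2) - of_real c * z \<noteq> 0" if "norm z < R" for z :: complex
  proof
    assume "of_real (r\<^sup>2) - of_real c * z = 0"
    then have "of_real (r\<^sup>2) = of_real c * z" by (simp only: right_minus_eq)
    then have "norm (of_real c * z) = norm (complex_of_real (r\<^sup>2))" by (simp only:)
    then have "c * norm z = r\<^sup>2" using c by (simp add: norm_mult norm_power)
    moreover have "norm z < r\<^sup>2 / c" using that by (simp add: R_def)
    ultimately show False using c by (simp add: field_simps)
  qed
  define G where "G = (\<lambda>z. g z - of_real (exp a) * z / (of_real (r\<^sup>2) - of_real c * z))"
  have G: "real_holomorphic R G"
    unfolding real_holomorphic_def
  proof (intro conjI allI impI)
    have "g holomorphic_on ball 0 R"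
      using g by (auto simp: real_holomorphic_def R_def intro: holomorphic_on_subset)
    then show "G holomorphic_on ball 0 R"
      unfolding G_def using den by (intro holomorphic_intros) auto
    show "G (of_real x) \<in> \<real>" if "\<bar>x\<bar> < R" for x :: real
      using g that unfolding G_def real_holomorphic_def R_def
      by (intro Reals_diff Reals_divide Reals_mult) auto
  qed
  obtain V where V1: "((\<lambda>\<theta>. \<theta> * Im (G (of_real r * cis \<theta>))) has_integral - pi * V) {0..pi}"
    and V2: "((\<lambda>u. (Re (G (of_real (-u))) - Re (G 0)) / u) has_integral V) {0..r}"
    using half_circle_integral[OF G R] by blast
  have circle: "Im (G (of_real r * cis \<theta>)) = Im (1 / (Ln (1 + of_real r * cis \<theta>) - of_real a))" for \<theta>
  proof -
    define z where "z = of_real r * cis \<theta>"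
    have nz: "norm z = r" using R by (simp add: z_def norm_mult)
    have zc: "z \<noteq> of_real c" using nz c by auto
    have z0: "z \<noteq> 0" using nz R by auto
    have "of_real (r\<^sup>2) - of_real c * z = z * (cnj z - of_real c)"
      using complex_norm_square[of z] nz by (simp add: algebra_simps)
    define w where "w = of_real (exp a) / (z - of_real c)"
    have "of_real (exp a) * z / (of_real (r\<^sup>2) - of_real c * z) = cnj w"
      unfolding \<open>of_real (r\<^sup>2) - of_real c * z = z * (cnj z - of_real c)\<close>
      using z0 by (simp add: w_def)
    then have "G z = g z - cnj w" by (simp only: G_def)
    then have "Im (G z) = Im (g z) + Im w" by simp
    also have "\<dots> = Im (1 / (Ln (1 + z) - of_real a))"
      using gz[OF _ zc] nz r by (simp add: w_def)
    finally show ?thesis by (simp add: z_def)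
  qed
  \<comment> \<open>Of the integrand \<open>(G (- u) - G 0) / u\<close>, the part that comes from the two principal parts is
    elementary; \<open>E\<close> is its antiderivative.\<close>
  define E where "E = (\<lambda>u. exp a / c * (ln (r\<^sup>2 + c * u) - ln (u + c)))"
  have E: "((\<lambda>u. exp a * (1 / (r\<^sup>2 + c * u) - 1 / (c * (u + c)))) has_integral E r - E 0) {0..r}"
  proof (rule fundamental_theorem_of_calculus)
    fix u assume u: "u \<in> {0..r}"
    have p: "0 < r\<^sup>2 + c * u" "0 < u + c" using u c R by (auto intro!: add_pos_nonneg)
    have "(E has_real_derivative exp a / c * (c / (r\<^sup>2 + c * u) - 1 / (u + c))) (at u within {0..r})"
      unfolding E_def using p c by (auto intro!: derivative_eq_intros)
    also have "exp a / c * (c / (r\<^sup>2 + c * u) - 1 / (u + c)) = exp a * (1 / (r\<^sup>2 + c * u) - 1 / (c * (u + c)))"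
      using c by (simp add: right_diff_distrib)
    finally have "(E has_real_derivative exp a * (1 / (r\<^sup>2 + c * u) - 1 / (c * (u + c)))) (at u within {0..r})" .
    then show "(E has_vector_derivative exp a * (1 / (r\<^sup>2 + c * u) - 1 / (c * (u + c)))) (at u within {0..r})"
      by (simp add: has_real_derivative_iff_has_vector_derivative)
  qed (use R in auto)
  have E': "E r - E 0 = exp a / c * ln (c / r)"
  proof -
    have "ln (r\<^sup>2 + c * r) = ln r + ln (r + c)"
      using R c ln_mult_pos[of r "r + c"] by (simp add: power2_eq_square algebra_simps)
    moreover have "ln (r\<^sup>2) = 2 * ln r" using R by (simp add: ln_realpow)
    moreover have "ln (c / r) = ln c - ln r" using R c by (simp add: ln_div)
    moreover have "E r - E 0 = exp a / c * ((ln (r\<^sup>2 + c * r) - ln (r + c)) - (ln (r\<^sup>2) - ln c))"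
      by (simp add: E_def right_diff_distrib)
    moreover have "K * ((ln r + ln (r + c) - ln (r + c)) - (2 * ln r - ln c)) = K * (ln c - ln r)" for K
      by (simp add: algebra_simps)
    ultimately show ?thesis by (simp only:)
  qed
  have ea: "exp a / c = 1 / (1 - exp (- a))"
    using c by (simp add: c_def exp_minus field_simps)
  define W where "W = V - (E r - E 0)"
  have "((\<lambda>u. (Re (G (of_real (-u))) - Re (G 0)) / u -
          exp a * (1 / (r\<^sup>2 + c * u) - 1 / (c * (u + c)))) has_integral W) {0..r}"
    unfolding W_def by (rule has_integral_diff[OF V2 E])
  then have "((\<lambda>u. (1 / a - 1 / (a - ln (1 - u))) / u) has_integral W) {0..r}"
  proof (rule has_integral_spike[of "{0}", rotated 2])
    fix u assume u': "u \<in> {0..r} - {0}"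
    then have u: "0 < u" "u < 1" "u \<le> r" using r by auto
    have lnu: "Ln (1 + of_real (- u)) = of_real (ln (1 - u))"
      using Ln_of_real[of "1 - u"] u by simp
    have "of_real (- u) \<noteq> complex_of_real c" using u c of_real_eq_iff[of "-u" c, where ?'a=complex] by linarith
    from gz[OF _ this] u
    have "g (of_real (- u)) = of_real (1 / (ln (1 - u) - a) - exp a / (- u - c))"
      unfolding lnu by (simp add: algebra_simps)
    then have 1: "Re (g (of_real (- u))) = 1 / (ln (1 - u) - a) - exp a / (- u - c)"
      by simp
    have "g 0 = of_real (- 1 / a + exp a / c)"
      using gz[of 0] c by (simp add: algebra_simps)
    then have 2: "Re (G 0) = - 1 / a + exp a / c"
      by (simp add: G_def)
    have 3: "Re (G (of_real (- u))) = 1 / (ln (1 - u) - a) - exp a / (- u - c) + exp a * u / (r\<^sup>2 + c * u)"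
    proof -
      have "of_real (exp a) * of_real (- u) / (of_real (r\<^sup>2) - of_real c * of_real (- u))
              = complex_of_real (- (exp a * u / (r\<^sup>2 + c * u)))"
        by simp
      then show ?thesis unfolding G_def using 1 by simp
    qed
    have p: "0 < r\<^sup>2 + c * u" "0 < u + c" using u c R by (auto intro!: add_pos_nonneg)
    have l: "1 / (ln (1 - u) - a) = - (1 / (a - ln (1 - u)))"
      by (metis minus_diff_eq minus_divide_right)
    have e: "exp a / (- u - c) = - (exp a / (u + c))"
      by (metis add.commute minus_add_distrib minus_divide_right uminus_add_conv_diff)
    have "exp a / (u + c) - exp a / c = - (u * (exp a * (1 / (c * (u + c)))))"
      using p c by (simp add: field_simps)
    then have "Re (G (of_real (- u))) - Re (G 0) =
        (1 / a - 1 / (a - ln (1 - u))) + u * (exp a * (1 / (r\<^sup>2 + c * u) - 1 / (c * (u + c))))"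
      unfolding 2 3 l e by (simp add: algebra_simps)
    then show "(1 / a - 1 / (a - ln (1 - u))) / u =
        (Re (G (of_real (-u))) - Re (G 0)) / u - exp a * (1 / (r\<^sup>2 + c * u) - 1 / (c * (u + c)))"
      using u by (simp add: add_divide_distrib)
  qed auto
  moreover have "V = W + ln (c / r) / (1 - exp (- a))"
    unfolding W_def E' ea by simp
  ultimately show ?thesis
    using that[of W] V1 unfolding circle by (simp add: c_def)
qed

section \<open>The limit case of the unit circle\<close>

text \<open>The exponential function is Lipschitz with constant \<open>2\<close> on the half plane \<open>Re w \<le> ln 2\<close>, which
  contains both \<open>a\<close> and \<open>Ln (1 + z)\<close>. So \<open>Ln (1 + z)\<close> can be close to \<open>a\<close> only if \<open>1 + z\<close> is close to
  \<open>e\<^sup>a\<close>. The bound stays uniform up to the unit circle, even near \<open>z = -1\<close>.\<close>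

lemma norm_reciprocal_log_le:
  fixes a :: real
  assumes a: "0 < a" "a < ln 2" and z: "norm z < 1" and r: "exp a - 1 < norm z"
  shows "norm (1 / (Ln (1 + z) - of_real a)) \<le> 2 / (norm z - (exp a - 1))"
proof -
  have z1: "1 + z \<noteq> 0" using one_plus_disc_notin_nonpos_Reals[OF z] by auto
  have "norm (exp (Ln (1 + z)) - exp (of_real a)) \<le> 2 * norm (Ln (1 + z) - of_real a)"
  proof (rule field_differentiable_bound[of "{w. Re w \<le> ln 2}"])
    show "convex {w. Re w \<le> ln 2}" by (rule convex_halfspace_Re_le)
    show "(exp has_field_derivative exp w) (at w within {w. Re w \<le> ln 2})" for w
      by (auto intro!: derivative_eq_intros)
    show "norm (exp w) \<le> 2" if "w \<in> {w. Re w \<le> ln 2}" for w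
    proof -
      have "exp (Re w) \<le> exp (ln 2)" using that by (subst exp_le_cancel_iff) simp
      then show ?thesis by simp
    qed
    have "norm (1 + z) \<le> 2" using norm_triangle_ineq[of 1 z] z by simp
    then show "Ln (1 + z) \<in> {w. Re w \<le> ln 2}" using z1 by (simp add: Re_Ln)
  qed (use a in auto)
  moreover have "exp (Ln (1 + z)) - exp (of_real a) = z - of_real (exp a - 1)"
    using z1 by (simp add: exp_of_real)
  moreover have "norm z - norm (complex_of_real (exp a - 1)) \<le> norm (z - of_real (exp a - 1))"
    by (rule norm_triangle_ineq2)
  moreover have "norm (complex_of_real (exp a - 1)) = exp a - 1"
    using a by (simp only: norm_of_real) simp
  ultimately have *: "norm z - (exp a - 1) \<le> 2 * norm (Ln (1 + z) - of_real a)"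
    by simp
  then have "0 < norm (Ln (1 + z) - of_real a)" using r by linarith
  with * r show ?thesis by (simp add: norm_divide field_simps)
qed

lemma Ln_one_plus_cis:
  assumes "0 < \<theta>" "\<theta> < pi"
  shows "Ln (1 + cis \<theta>) = Complex (ln (2 * cos (\<theta> / 2))) (\<theta> / 2)"
proof -
  have c: "0 < cos (\<theta> / 2)" using assms by (intro cos_gt_zero) auto
  have "1 + cis \<theta> = of_real (2 * cos (\<theta> / 2)) * cis (\<theta> / 2)"
    using cos_double_cos[of "\<theta> / 2"] sin_double[of "\<theta> / 2"]
    by (auto simp: complex_eq_iff power2_eq_square)
  then have "Ln (1 + cis \<theta>) = of_real (ln (2 * cos (\<theta> / 2))) + Ln (cis (\<theta> / 2))"
    using c Ln_of_real[of "2 * cos (\<theta> / 2)"] by (simp add: Ln_times_of_real del: of_real_mult)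
  also have "Ln (cis (\<theta> / 2)) = \<i> * of_real (\<theta> / 2)"
    unfolding cis_conv_exp using assms by (intro Ln_exp) auto
  finally show ?thesis by (simp add: complex_eq_iff)
qed

lemma Im_reciprocal_log_cis:
  assumes "0 < \<theta>" "\<theta> < pi"
  shows "Im (1 / (Ln (1 + cis \<theta>) - of_real a)) =
           - (\<theta> / 2) / ((\<theta> / 2)\<^sup>2 + (ln (2 * exp (- a) * cos (\<theta> / 2)))\<^sup>2)"
proof -
  have c: "0 < cos (\<theta> / 2)" using assms by (intro cos_gt_zero) auto
  have "ln (2 * exp (- a) * cos (\<theta> / 2)) = ln (2 * cos (\<theta> / 2)) - a"
    using c ln_mult[of "2 * cos (\<theta> / 2)" "exp (- a)"] by (simp add: mult_ac)
  then show ?thesis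
    by (simp add: Ln_one_plus_cis[OF assms] Im_divide power2_eq_square add.commute)
qed

lemma M_eq_reciprocal_log_integral:
  fixes a :: real
  assumes "((\<lambda>\<theta>. \<theta> * Im (1 / (Ln (1 + cis \<theta>) - of_real a))) has_integral - pi * I) {0<..<pi}"
  shows "M a = I"
proof -
  have "((\<lambda>\<theta>. (- 1 / 2) * (\<theta> * Im (1 / (Ln (1 + cis \<theta>) - of_real a)))) has_integral (- 1 / 2) * (- pi * I)) {0<..<pi}"
    by (intro has_integral_mult_right assms)
  then have "((\<lambda>\<theta>. (\<theta> / 2)\<^sup>2 / ((\<theta> / 2)\<^sup>2 + (ln (2 * exp (- a) * cos (\<theta> / 2)))\<^sup>2))
               has_integral (- 1 / 2) * (- pi * I)) {0<..<pi}"
  proof (rule has_integral_eq[rotated])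
    fix \<theta> :: real assume "\<theta> \<in> {0<..<pi}"
    then have \<theta>: "0 < \<theta>" "\<theta> < pi" by auto
    show "(- 1 / 2) * (\<theta> * Im (1 / (Ln (1 + cis \<theta>) - of_real a))) =
          (\<theta> / 2)\<^sup>2 / ((\<theta> / 2)\<^sup>2 + (ln (2 * exp (- a) * cos (\<theta> / 2)))\<^sup>2)"
      unfolding Im_reciprocal_log_cis[OF \<theta>] by (simp add: power2_eq_square)
  qed
  then have "((\<lambda>\<theta>. (\<theta> / 2)\<^sup>2 / ((\<theta> / 2)\<^sup>2 + (ln (2 * exp (- a) * cos (\<theta> / 2)))\<^sup>2))
               has_integral pi * I / 2) {0..pi}"
    by (simp add: has_integral_Icc_iff_Ioo)
  from has_integral_affinity'[of _ _ 0 pi 2 0, OF this[unfolded cbox_interval[symmetric]]]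
  have "((\<lambda>x. x\<^sup>2 / (x\<^sup>2 + (ln (2 * exp (- a) * cos x))\<^sup>2)) has_integral pi * I / 4) {0..pi / 2}"
    by simp
  then have "integral {0..pi / 2} (\<lambda>x. x\<^sup>2 / (x\<^sup>2 + (ln (2 * exp (- a) * cos x))\<^sup>2)) = pi * I / 4"
    by (rule integral_unique)
  then show ?thesis by (simp only: M_def) simp
qed

lemma integrable_const_Ioo: "(\<lambda>_. c :: real) integrable_on {a<..<b::real}"
  using integrable_const_ivl[of c a b] by (simp add: integrable_on_Icc_iff_Ioo)

text \<open>The circles of radius \<open>r n\<close> increase to the unit circle. On the one side the integrands are
  uniformly bounded and converge pointwise on \<open>(0, \<pi>)\<close>; on the other side the integral over
  \<open>[0, r n]\<close> depends continuously on its upper limit.\<close>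

lemma M_eq_unit_interval_integral:
  fixes a :: real
  assumes a: "0 < a" "a < ln 2"
    and J: "((\<lambda>u. (1 / a - 1 / (a - ln (1 - u))) / u) has_integral J) {0..1}"
  shows "M a = J + (a + ln (1 - exp (- a))) / (1 - exp (- a))"
proof -
  define c where "c = exp a - 1"
  have c: "0 < c" "c < 1" using exp_minus_1_bounds[OF a] by (auto simp: c_def)
  define k where "k = (\<lambda>u. (1 / a - 1 / (a - ln (1 - u))) / u)"
  define f where "f = (\<lambda>z. 1 / (Ln (1 + z) - of_real a))"
  \<comment> \<open>The radii start at \<open>(1 + c) / 2\<close> so that they keep a fixed distance from the pole \<open>c\<close>.\<close>
  define r where "r = (\<lambda>n. 1 - (1 - c) / 2 / real (Suc n))"
  have rlim: "r \<longlonglongrightarrow> 1"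
    unfolding r_def by real_asymp
  have r: "(1 + c) / 2 \<le> r n" "r n < 1" for n
  proof -
    have "(1 - c) / 2 / real (Suc n) \<le> (1 - c) / 2 / 1"
      using c by (intro divide_left_mono) auto
    then show "(1 + c) / 2 \<le> r n" by (simp add: r_def field_simps)
    show "r n < 1" using c by (simp add: r_def)
  qed
  have rc: "c < r n" "0 < r n" for n using r[of n] c by auto
  have circ: "((\<lambda>\<theta>. \<theta> * Im (f (of_real (r n) * cis \<theta>))) has_integral
               - pi * (integral {0..r n} k + ln (c / r n) / (1 - exp (- a)))) {0<..<pi}" for n
  proof (rule circle_integral_reciprocal_log[OF a, of "r n"])
    fix W
    assume 1: "((\<lambda>\<theta>. \<theta> * Im (1 / (Ln (1 + of_real (r n) * cis \<theta>) - of_real a))) has_integral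
        - pi * (W + ln ((exp a - 1) / r n) / (1 - exp (- a)))) {0..pi}"
      and 2: "((\<lambda>u. (1 / a - 1 / (a - ln (1 - u))) / u) has_integral W) {0..r n}"
    from 2 have "integral {0..r n} k = W" unfolding k_def by (rule integral_unique)
    with 1 show ?thesis by (simp only: has_integral_Icc_iff_Ioo f_def c_def)
  qed (use r[of n] rc[of n] in \<open>auto simp: c_def\<close>)
  have bound: "norm (\<theta> * Im (f (of_real (r n) * cis \<theta>))) \<le> pi * (2 / ((1 + c) / 2 - c))"
    if "\<theta> \<in> {0<..<pi}" for n \<theta>
  proof -
    have nz: "norm (of_real (r n) * cis \<theta>) = r n" using rc[of n] by (simp add: norm_mult)
    have "\<bar>Im (f (of_real (r n) * cis \<theta>))\<bar> \<le> norm (f (of_real (r n) * cis \<theta>))"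
      by (rule abs_Im_le_cmod)
    also have "\<dots> \<le> 2 / (r n - c)"
      using norm_reciprocal_log_le[OF a, of "of_real (r n) * cis \<theta>"] nz rc[of n] r[of n]
      by (simp add: f_def c_def)
    also have "\<dots> \<le> 2 / ((1 + c) / 2 - c)"
      using r[of n] rc[of n] c by (intro divide_left_mono) auto
    finally show ?thesis
      using that unfolding real_norm_def abs_mult by (intro mult_mono) auto
  qed
  have conv: "(\<lambda>n. \<theta> * Im (f (of_real (r n) * cis \<theta>))) \<longlonglongrightarrow> \<theta> * Im (f (cis \<theta>))"
    if "\<theta> \<in> {0<..<pi}" for \<theta>
  proof -
    have t: "0 < \<theta>" "\<theta> < pi" using that by auto
    have "Im (1 + cis \<theta>) > 0" using sin_gt_zero t by simp
    then have np: "1 + cis \<theta> \<notin> \<real>\<^sub>\<le>\<^sub>0" by (auto simp: complex_nonpos_Reals_iff)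
    have "Ln (1 + cis \<theta>) - of_real a \<noteq> 0"
      using t by (simp add: Ln_one_plus_cis[OF t] complex_eq_iff)
    moreover have "(\<lambda>n. of_real (r n) * cis \<theta>) \<longlonglongrightarrow> of_real 1 * cis \<theta>"
      by (intro tendsto_intros rlim)
    then have "(\<lambda>n. of_real (r n) * cis \<theta>) \<longlonglongrightarrow> cis \<theta>" by simp
    ultimately have "(\<lambda>n. f (of_real (r n) * cis \<theta>)) \<longlonglongrightarrow> f (cis \<theta>)"
      unfolding f_def using np by (intro tendsto_intros tendsto_Ln) auto
    then show ?thesis by (intro tendsto_intros)
  qed
  have dct: "(\<lambda>\<theta>. \<theta> * Im (f (cis \<theta>))) integrable_on {0<..<pi}"
    "(\<lambda>n. integral {0<..<pi} (\<lambda>\<theta>. \<theta> * Im (f (of_real (r n) * cis \<theta>))))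
        \<longlonglongrightarrow> integral {0<..<pi} (\<lambda>\<theta>. \<theta> * Im (f (cis \<theta>)))"
    using dominated_convergence[where f = "\<lambda>n \<theta>. \<theta> * Im (f (of_real (r n) * cis \<theta>))"
        and g = "\<lambda>\<theta>. \<theta> * Im (f (cis \<theta>))"
        and h = "\<lambda>_. pi * (2 / ((1 + c) / 2 - c))" and S = "{0<..<pi}",
        OF has_integral_integrable[OF circ] integrable_const_Ioo bound conv]
    by blast+
  have "((\<lambda>x. integral {0..x} k) \<longlongrightarrow> integral {0..1} k) (at 1 within {0..1})"
    using indefinite_integral_continuous_1[of k 0 1] J
    by (auto simp: k_def continuous_on_def)
  moreover have "filterlim r (at 1 within {0..1}) sequentially"
    using rlim r(2) rc(2) by (auto simp: filterlim_at less_imp_le less_imp_neq)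
  ultimately have "(\<lambda>n. integral {0..r n} k) \<longlonglongrightarrow> integral {0..1} k"
    by (rule filterlim_compose)
  moreover have "integral {0..1} k = J" using J by (simp add: k_def integral_unique)
  ultimately have "(\<lambda>n. - pi * (integral {0..r n} k + ln (c / r n) / (1 - exp (- a))))
      \<longlonglongrightarrow> - pi * (J + ln (c / 1) / (1 - exp (- a)))"
    using a c by (intro tendsto_intros rlim) auto
  moreover have "integral {0<..<pi} (\<lambda>\<theta>. \<theta> * Im (f (of_real (r n) * cis \<theta>)))
       = - pi * (integral {0..r n} k + ln (c / r n) / (1 - exp (- a)))" for n
    by (rule integral_unique[OF circ])
  ultimately have "integral {0<..<pi} (\<lambda>\<theta>. \<theta> * Im (f (cis \<theta>))) = - pi * (J + ln c / (1 - exp (- a)))"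
    using LIMSEQ_unique[OF dct(2)] by simp
  then have "M a = J + ln c / (1 - exp (- a))"
    using dct(1) by (intro M_eq_reciprocal_log_integral) (simp add: has_integral_iff f_def)
  also have "ln c = a + ln (1 - exp (- a))"
  proof -
    have "c = exp a * (1 - exp (- a))" by (simp add: c_def algebra_simps exp_minus)
    then show ?thesis using a by (simp add: ln_mult)
  qed
  finally show ?thesis .
qed

section \<open>Integrals over the positive half line\<close>

lemma continuous_dominated_absolutely_integrable:
  fixes f h :: "real \<Rightarrow> real"
  assumes f: "continuous_on {0<..} f" and h: "h integrable_on {0<..}"
    and le: "\<And>t. t > 0 \<Longrightarrow> \<bar>f t\<bar> \<le> h t"
  shows "f absolutely_integrable_on {0<..}"
proof -
  have "f integrable_on {0<..}"
    using continuous_imp_measurable_on_sets_lebesgue[OF f] h le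
    by (intro measurable_bounded_by_integrable_imp_integrable_real[of f _ h]) auto
  then show ?thesis
    using h le by (intro absolutely_integrable_integrable_bound[of _ f h]) auto
qed

text \<open>Absolute integrability lets the integral over the half line be computed as the limit of the
  integrals over the intervals \<open>[1 / (n + 1), n + 1]\<close>.\<close>

lemma has_integral_FTC_greaterThan_0:
  fixes f F :: "real \<Rightarrow> real"
  assumes F: "\<And>t. t > 0 \<Longrightarrow> (F has_real_derivative f t) (at t)"
    and f: "f absolutely_integrable_on {0<..}"
    and A: "(F \<longlongrightarrow> A) (at_right 0)" and B: "(F \<longlongrightarrow> B) at_top"
  shows "(f has_integral B - A) {0<..}"
proof -
  define l u where "l = (\<lambda>n. 1 / real (Suc n))" and "u = (\<lambda>n. real (Suc n))"
  define g where "g = (\<lambda>n t. if t \<in> {l n..u n} then f t else 0)"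
  have l: "0 < l n" "l n \<le> 1" and u: "1 \<le> u n" for n by (auto simp: l_def u_def)
  have g: "(g n has_integral F (u n) - F (l n)) {0<..}" for n
  proof -
    have "(f has_integral F (u n) - F (l n)) {l n..u n}"
    proof (rule fundamental_theorem_of_calculus)
      show "l n \<le> u n" using l(2)[of n] u[of n] by linarith
      show "(F has_vector_derivative f t) (at t within {l n..u n})" if "t \<in> {l n..u n}" for t
        using F[of t] l(1)[of n] that
        by (auto simp: has_real_derivative_iff_has_vector_derivative intro: has_vector_derivative_at_within)
    qed
    moreover have "{l n..u n} \<subseteq> {0<..}" using l(1)[of n] by auto
    ultimately show ?thesis
      unfolding g_def by (simp only: has_integral_restrict)
  qed
  have conv: "(\<lambda>n. g n t) \<longlonglongrightarrow> f t" if "t \<in> {0<..}" for t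
  proof -
    have "\<forall>\<^sub>F n in sequentially. l n < t"
      unfolding l_def using that by real_asymp
    moreover have "\<forall>\<^sub>F n in sequentially. t < u n"
      unfolding u_def by real_asymp
    ultimately have "\<forall>\<^sub>F n in sequentially. g n t = f t"
      by eventually_elim (auto simp: g_def)
    then show ?thesis by (rule tendsto_eventually)
  qed
  have h: "(\<lambda>t. \<bar>f t\<bar>) integrable_on {0<..}"
    using f by (simp add: absolutely_integrable_on_def)
  have bound: "norm (g n t) \<le> \<bar>f t\<bar>" for n t by (simp add: g_def)
  note dct = dominated_convergence[of g "{0<..}" "\<lambda>t. \<bar>f t\<bar>" f,
      OF has_integral_integrable[OF g] h bound conv]
  have "filterlim l (at_right 0) sequentially" "filterlim u at_top sequentially"
    unfolding l_def u_def by real_asymp+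
  then have "(\<lambda>n. F (u n) - F (l n)) \<longlonglongrightarrow> B - A"
    by (intro tendsto_diff filterlim_compose[OF A] filterlim_compose[OF B])
  moreover have "(\<lambda>n. F (u n) - F (l n)) \<longlonglongrightarrow> integral {0<..} f"
    using dct(2) by (simp add: integral_unique[OF g])
  ultimately have "integral {0<..} f = B - A" by (rule LIMSEQ_unique[rotated])
  with dct(1) show ?thesis by (simp add: has_integral_iff)
qed

text \<open>Euler's integral for \<open>Gamma s\<close>, rescaled by \<open>t \<mapsto> a * t\<close>. Besides giving exact values it supplies
  the integrable majorants used below.\<close>

lemma has_integral_powr_times_exp:
  fixes a s :: real
  assumes a: "0 < a" and s: "0 < s"
  shows "((\<lambda>t. t powr (s - 1) * exp (- a * t)) has_integral Gamma s / a powr s) {0<..}"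
proof -
  define f where "f = (\<lambda>t. t powr (s - 1) / exp t)"
  have f: "(f has_integral Gamma s) {0<..}"
    using Gamma_integral_real[OF s] unfolding f_def
    by (subst has_integral_spike_set_eq[where T = "{0..}"]) (auto intro: negligible_subset[of "{0}"])
  then have "f absolutely_integrable_on {0<..} \<and> integral {0<..} f = Gamma s"
    by (auto simp: absolutely_integrable_on_iff_nonneg f_def has_integral_iff)
  moreover have "(\<lambda>t. a * t) ` {0<..} = {0<..}"
    using a by (auto simp: image_iff intro!: bexI[of _ "_ / a"])
  ultimately have "(\<lambda>t. \<bar>a\<bar> * f (a * t)) absolutely_integrable_on {0<..} \<and>
      integral {0<..} (\<lambda>t. \<bar>a\<bar> * f (a * t)) = Gamma s"
    using a by (subst has_absolute_integral_change_of_variables_1')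
      (auto intro!: derivative_eq_intros inj_onI)
  then have "((\<lambda>t. \<bar>a\<bar> * f (a * t)) has_integral Gamma s) {0<..}"
    by (auto simp: has_integral_iff dest: set_lebesgue_integral_eq_integral)
  then have "((\<lambda>t. \<bar>a\<bar> * f (a * t) * a powr (- s)) has_integral Gamma s * a powr (- s)) {0<..}"
    by (rule has_integral_mult_left)
  then have "((\<lambda>t. t powr (s - 1) * exp (- a * t)) has_integral Gamma s * a powr (- s)) {0<..}"
  proof (rule has_integral_eq[rotated])
    fix t :: real assume "t \<in> {0<..}"
    have "a * a powr (s - 1) * a powr (- s) = 1"
      using a powr_add[of a "s - 1" "- s"] by (simp add: powr_minus field_simps)
    then show "\<bar>a\<bar> * f (a * t) * a powr (- s) = t powr (s - 1) * exp (- a * t)"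
      using a \<open>t \<in> _\<close> by (simp add: f_def powr_mult exp_minus field_simps)
  qed
  then show ?thesis by (simp add: powr_minus field_simps)
qed

text \<open>Since \<open>ln t\<close> is the derivative of \<open>t powr s\<close> at \<open>s = 0\<close>, the integral is the derivative at \<open>0\<close> of
  \<open>s \<mapsto> Gamma (1 + s) / a powr (1 + s)\<close>, where \<open>Digamma 1 = - euler_mascheroni\<close> enters.
  Differentiation under the integral sign is justified along \<open>s = 1 / (n + 1)\<close> by dominated
  convergence.\<close>

lemma has_integral_ln_times_exp:
  fixes a :: real
  assumes a: "0 < a"
  shows "((\<lambda>t. exp (- a * t) * ln t) has_integral - (euler_mascheroni + ln a) / a) {0<..}"
proof -
  define s where "s = (\<lambda>n. 1 / real (Suc n))"
  have s: "0 < s n" "s n \<le> 1" for n by (auto simp: s_def)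
  define q where "q = (\<lambda>n t. real (Suc n) * (t powr s n - 1))"
  define G where "G = (\<lambda>s. Gamma (1 + s) / a powr (1 + s))"
  define f where "f = (\<lambda>n t. exp (- a * t) * q n t)"
  have int: "((\<lambda>t. t powr p * exp (- a * t)) has_integral Gamma (1 + p) / a powr (1 + p)) {0<..}"
    if "p > -1" for p
    using has_integral_powr_times_exp[OF a, of "1 + p"] that by simp
  have f: "(f n has_integral (G (s n) - G 0) / s n) {0<..}" for n
  proof -
    have "((\<lambda>t. real (Suc n) * (t powr s n * exp (- a * t) - t powr 0 * exp (- a * t))) has_integral
            real (Suc n) * (G (s n) - G 0)) {0<..}"
      unfolding G_def using s(1)[of n] by (intro has_integral_mult_right has_integral_diff int) auto
    then have "(f n has_integral real (Suc n) * (G (s n) - G 0)) {0<..}"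
      by (rule has_integral_eq[rotated]) (auto simp: f_def q_def algebra_simps)
    then show ?thesis by (simp add: s_def mult.commute)
  qed
  have bound: "norm (f n t) \<le> 2 * (t powr (- 1 / 2) * exp (- a * t)) + t powr 1 * exp (- a * t)"
    if "t \<in> {0<..}" for n t
  proof -
    have t: "0 < t" using that by simp
    \<comment> \<open>Convexity gives \<open>ln t \<le> q n t \<le> t - 1\<close>; the upper bound is Bernoulli's inequality for the
      \<open>(n + 1)\<close>-st root of \<open>t\<close>.\<close>
    have "1 + s n * ln t \<le> exp (s n * ln t)" by (rule exp_ge_add_one_self)
    then have lower: "ln t \<le> q n t"
      using t by (simp add: q_def s_def powr_def field_simps)
    have "1 + real (Suc n) * (t powr s n - 1) \<le> (1 + (t powr s n - 1)) ^ Suc n"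
      by (rule Bernoulli_inequality) auto
    also have "\<dots> = t"
      using t by (simp add: s_def powr_realpow[symmetric] powr_powr del: power_Suc)
    finally have upper: "q n t \<le> t" by (simp add: q_def)
    \<comment> \<open>Near \<open>0\<close> the logarithm is dominated by \<open>t powr (- 1 / 2)\<close>, whose Laplace transform is finite.\<close>
    have "ln (t powr (- 1 / 2)) \<le> t powr (- 1 / 2)"
      using ln_le_minus_one[of "t powr (- 1 / 2)"] t by simp
    then have "- ln t \<le> 2 * t powr (- 1 / 2)" using t by (simp add: ln_powr)
    then have "\<bar>q n t\<bar> \<le> 2 * t powr (- 1 / 2) + t"
      using lower upper t powr_ge_zero[of t "- 1 / 2"] by (intro abs_leI) linarith+
    then have "exp (- a * t) * \<bar>q n t\<bar> \<le> exp (- a * t) * (2 * t powr (- 1 / 2) + t)"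
      by (intro mult_left_mono) auto
    then show ?thesis using t by (simp add: f_def abs_mult algebra_simps)
  qed
  have h: "(\<lambda>t. 2 * (t powr (- 1 / 2) * exp (- a * t)) + t powr 1 * exp (- a * t)) integrable_on {0<..}"
    by (intro integrable_add integrable_on_mult_right has_integral_integrable[OF int]) auto
  have conv: "(\<lambda>n. f n t) \<longlonglongrightarrow> exp (- a * t) * ln t" if "t \<in> {0<..}" for t
  proof -
    have "0 < t" using that by simp
    then have "(\<lambda>n. real (Suc n) * (t powr (1 / real (Suc n)) - 1)) \<longlonglongrightarrow> ln t"
      by real_asymp
    then show ?thesis unfolding f_def q_def s_def by (intro tendsto_intros)
  qed
  note dct = dominated_convergence[of f "{0<..}" _ "\<lambda>t. exp (- a * t) * ln t",
      OF has_integral_integrable[OF f] h bound conv]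
  have "(G has_real_derivative - (euler_mascheroni + ln a) / a) (at 0)"
    unfolding G_def using a
    by (auto intro!: derivative_eq_intros simp: field_simps power2_eq_square)
  then have "((\<lambda>h. (G h - G 0) / h) \<longlongrightarrow> - (euler_mascheroni + ln a) / a) (at 0)"
    by (simp add: DERIV_def)
  moreover have "filterlim s (at 0) sequentially"
    unfolding s_def by real_asymp
  ultimately have "(\<lambda>n. (G (s n) - G 0) / s n) \<longlonglongrightarrow> - (euler_mascheroni + ln a) / a"
    by (rule filterlim_compose)
  moreover have "(\<lambda>n. (G (s n) - G 0) / s n) \<longlonglongrightarrow> integral {0<..} (\<lambda>t. exp (- a * t) * ln t)"
    using dct(2) by (simp add: integral_unique[OF f])
  ultimately have "integral {0<..} (\<lambda>t. exp (- a * t) * ln t) = - (euler_mascheroni + ln a) / a"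
    by (rule LIMSEQ_unique[rotated])
  with dct(1) show ?thesis by (simp add: has_integral_iff)
qed

section \<open>The Laplace transform of the digamma function as an integral over the unit interval\<close>

lemma Digamma_plus1_sums:
  fixes t :: real
  assumes "0 \<le> t"
  shows "(\<lambda>k. 1 / real (Suc k) - 1 / (t + real (Suc k))) sums (Digamma (t + 1) + euler_mascheroni)"
proof -
  have "t + 1 \<noteq> 0" using assms by linarith
  from summable_sums[OF summable_Digamma[OF this]] show ?thesis
    by (simp add: Digamma_def inverse_eq_divide add_ac)
qed

text \<open>Each term of the series lies between \<open>0\<close> and \<open>t / (k + 1)\<^sup>2\<close>. Linear growth suffices to make the
  Laplace transforms converge.\<close>

lemma Digamma_plus1_bounds:
  obtains C :: real where "0 \<le> C"
    "\<And>t::real. 0 \<le> t \<Longrightarrow> 0 \<le> Digamma (t + 1) + euler_mascheroni"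
    "\<And>t. 0 \<le> t \<Longrightarrow> Digamma (t + 1) + euler_mascheroni \<le> C * t"
proof -
  have sm: "summable (\<lambda>k. 1 / (real (Suc k))\<^sup>2)"
    using inverse_power_summable[of 2, where ?'a=real] 
    by (subst summable_Suc_iff) (simp add: inverse_eq_divide)
  define C where "C = (\<Sum>k. 1 / (real (Suc k))\<^sup>2)"
  have tm: "0 \<le> 1 / real (Suc k) - 1 / (t + real (Suc k))"
             "1 / real (Suc k) - 1 / (t + real (Suc k)) \<le> 1 / (real (Suc k))\<^sup>2 * t"
    if "0 \<le> t" for k and t :: real
  proof -
    have "1 / real (Suc k) - 1 / (t + real (Suc k)) = t / (real (Suc k) * (t + real (Suc k)))"
      using that by (simp add: field_simps)
    moreover have "t / (real (Suc k) * (t + real (Suc k))) \<le> t / (real (Suc k))\<^sup>2"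
      unfolding power2_eq_square using that by (intro divide_left_mono mult_left_mono mult_pos_pos) auto
    ultimately show "0 \<le> 1 / real (Suc k) - 1 / (t + real (Suc k))"
             "1 / real (Suc k) - 1 / (t + real (Suc k)) \<le> 1 / (real (Suc k))\<^sup>2 * t"
      using that by auto
  qed
  show ?thesis
  proof (rule that[of C])
    show "0 \<le> C" unfolding C_def by (rule suminf_nonneg[OF sm]) auto
    show "0 \<le> Digamma (t + 1) + euler_mascheroni" if "0 \<le> t" for t :: real
      by (rule sums_le[OF tm(1)[OF that] sums_zero Digamma_plus1_sums[OF that]])
    show "Digamma (t + 1) + euler_mascheroni \<le> C * t" if "0 \<le> t" for t :: real
      unfolding C_def
      by (rule sums_le[OF tm(2)[OF that] Digamma_plus1_sums[OF that] sums_mult2[OF summable_sums[OF sm]]])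
  qed
qed


text \<open>Expanding \<open>1 / (1 - x)\<close> as a geometric series and integrating the nonnegative terms
  \<open>x powr k - x powr (t + k)\<close> one by one gives the series of the digamma function.\<close>

lemma nn_integral_powr_difference_quotient:
  fixes t :: real
  assumes t: "0 \<le> t"
  shows "(\<integral>\<^sup>+x. ennreal ((1 - x powr t) / (1 - x)) * indicator {0<..<1} x \<partial>lborel) =
           ennreal (Digamma (t + 1) + euler_mascheroni)"
proof -
  define p where "p = (\<lambda>k x. x powr real k - x powr (t + real k))"
  have p_nonneg: "0 \<le> p k x" if "x \<in> {0<..<1}" for k x
    using that t unfolding p_def by (auto intro!: powr_mono')
  have psum: "(\<lambda>k. p k x) sums ((1 - x powr t) / (1 - x))" if "x \<in> {0<..<1}" for x
  proof -
    have "(\<lambda>k. x ^ k * (1 - x powr t)) sums (1 / (1 - x) * (1 - x powr t))"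
      using that by (intro sums_mult2 geometric_sums) auto
    moreover have "p k x = x ^ k * (1 - x powr t)" for k
      using that by (simp add: p_def powr_add powr_realpow algebra_simps)
    ultimately show ?thesis by simp
  qed
  have pint: "(\<integral>\<^sup>+x. ennreal (p k x) * indicator {0<..<1} x \<partial>lborel) =
                ennreal (1 / real (Suc k) - 1 / (t + real (Suc k)))" for k
  proof (rule nn_integral_has_integral_lebesgue'[OF p_nonneg])
    have "(p k has_integral (1 powr (real k + 1) / (real k + 1) -
             1 powr (t + real k + 1) / (t + real k + 1))) {0..1}"
      unfolding p_def using t by (intro has_integral_diff has_integral_powr_from_0) auto
    then show "(p k has_integral 1 / real (Suc k) - 1 / (t + real (Suc k))) {0<..<1}"
      by (simp add: has_integral_Icc_iff_Ioo add_ac)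
  qed
  have meas: "(\<lambda>x. ennreal (p k x) * indicator {0<..<1} x) \<in> borel_measurable lborel" for k
    unfolding p_def by measurable
  have nonneg: "0 \<le> 1 / real (Suc k) - 1 / (t + real (Suc k))" for k
    using t by (simp add: frac_le)
  have "(\<integral>\<^sup>+x. ennreal ((1 - x powr t) / (1 - x)) * indicator {0<..<1} x \<partial>lborel) =
        (\<integral>\<^sup>+x. (\<Sum>k. ennreal (p k x) * indicator {0<..<1} x) \<partial>lborel)"
  proof (rule nn_integral_cong)
    fix x :: real
    show "ennreal ((1 - x powr t) / (1 - x)) * indicator {0<..<1} x =
            (\<Sum>k. ennreal (p k x) * indicator {0<..<1} x)"
    proof (cases "x \<in> {0<..<1}")
      case True
      have "(\<Sum>k. ennreal (p k x)) = ennreal ((1 - x powr t) / (1 - x))"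
        using psum[OF True] p_nonneg[OF True] by (metis suminf_ennreal_eq)
      with True show ?thesis by simp
    qed simp
  qed
  also have "\<dots> = (\<Sum>k. ennreal (1 / real (Suc k) - 1 / (t + real (Suc k))))"
    by (subst nn_integral_suminf[OF meas]) (simp only: pint)
  also have "\<dots> = ennreal (Digamma (t + 1) + euler_mascheroni)"
    by (rule suminf_ennreal_eq[OF nonneg Digamma_plus1_sums[OF t]])
  finally show ?thesis .
qed

text \<open>Because \<open>x powr t = exp (t * ln x)\<close>, this is the difference of the Laplace transforms of two
  exponential functions.\<close>

lemma nn_integral_exp_minus_powr:
  fixes a x :: real
  assumes a: "0 < a" and x: "x \<in> {0<..<1}"
  shows "(\<integral>\<^sup>+t. ennreal (exp (- a * t) * (1 - x powr t)) * indicator {0..} t \<partial>lborel) =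
           ennreal (1 / a - 1 / (a - ln x))"
proof -
  define b where "b = a - ln x"
  have b: "0 < b" using a x by (simp add: b_def less_trans[of "ln x" 0 a])
  define F where "F = (\<lambda>t. exp (- b * t) / b - exp (- a * t) / a)"
  have "(\<integral>\<^sup>+t. ennreal (exp (- a * t) * (1 - x powr t)) * indicator {0..} t \<partial>lborel) =
          ennreal (0 - F 0)"
  proof (rule nn_integral_FTC_atLeast)
    show "(\<lambda>t. exp (- a * t) * (1 - x powr t)) \<in> borel_measurable borel" by measurable
    show "(F has_real_derivative exp (- a * t) * (1 - x powr t)) (at t)" for t
    proof -
      have "(F has_real_derivative exp (- a * t) - exp (- b * t)) (at t)"
        unfolding F_def using a b by (auto intro!: derivative_eq_intros)
      moreover have "exp (- b * t) = exp (- a * t) * x powr t"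
        using x by (simp add: b_def powr_def exp_add[symmetric] algebra_simps)
      ultimately show ?thesis by (simp add: algebra_simps)
    qed
    show "0 \<le> exp (- a * t) * (1 - x powr t)" if "0 \<le> t" for t
      using that x powr_mono'[of 0 t x] by simp
    show "(F \<longlongrightarrow> 0) at_top"
    proof -
      have l: "((\<lambda>t. exp (- c * t)) \<longlongrightarrow> 0) at_top" if "0 < c" for c :: real
        using that by real_asymp
      show ?thesis
        unfolding F_def
        using tendsto_diff[OF tendsto_divide_zero[OF l[OF b]] tendsto_divide_zero[OF l[OF a]]] by simp
    qed
  qed
  then show ?thesis by (simp add: F_def b_def)
qed

text \<open>Both sides are iterated integrals of \<open>e\<^sup>-\<^sup>a\<^sup>t * (1 - x powr t) / (1 - x)\<close> over
  \<open>0 < x < 1\<close> and \<open>t \<ge> 0\<close>, so Tonelli's theorem applies.\<close>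

lemma nn_integral_Laplace_Digamma:
  fixes a :: real
  assumes a: "0 < a"
  shows "(\<integral>\<^sup>+x. ennreal ((1 / a - 1 / (a - ln x)) / (1 - x)) * indicator {0<..<1} x \<partial>lborel) =
         (\<integral>\<^sup>+t. ennreal (exp (- a * t) * (Digamma (t + 1) + euler_mascheroni)) * indicator {0..} t \<partial>lborel)"
proof -
  define h :: "real \<Rightarrow> real \<Rightarrow> ennreal" where
    "h = (\<lambda>x t. ennreal (exp (- a * t)) * (ennreal ((1 - x powr t) / (1 - x)) * indicator {0<..<1} x) * indicator {0..} t)"
  have meas: "case_prod h \<in> borel_measurable (lborel \<Otimes>\<^sub>M lborel)"
    unfolding h_def by measurable
  have x_section: "ennreal ((1 / a - 1 / (a - ln x)) / (1 - x)) * indicator {0<..<1} x = (\<integral>\<^sup>+t. h x t \<partial>lborel)" for x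
  proof (cases "x \<in> {0<..<1}")
    case True
    have "h x t = ennreal (1 / (1 - x)) * (ennreal (exp (- a * t) * (1 - x powr t)) * indicator {0..} t)" for t
    proof (cases "0 \<le> t")
      case t: True
      have "0 \<le> 1 - x powr t" using t True powr_mono'[of 0 t x] by simp
      then show ?thesis
        using True t by (simp add: h_def ennreal_mult'[symmetric] field_simps)
    qed (simp add: h_def)
    then have "(\<integral>\<^sup>+t. h x t \<partial>lborel) = ennreal (1 / (1 - x)) * ennreal (1 / a - 1 / (a - ln x))"
      using nn_integral_exp_minus_powr[OF a True] by (simp add: nn_integral_cmult)
    then show ?thesis using True by (simp add: ennreal_mult'[symmetric])
  qed (simp add: h_def)
  have t_section: "ennreal (exp (- a * t) * (Digamma (t + 1) + euler_mascheroni)) * indicator {0..} t = (\<integral>\<^sup>+x. h x t \<partial>lborel)" for t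
  proof (cases "0 \<le> t")
    case True
    have "(\<integral>\<^sup>+x. h x t \<partial>lborel) = ennreal (exp (- a * t)) * ennreal (Digamma (t + 1) + euler_mascheroni)"
      using True nn_integral_powr_difference_quotient[OF True]
      by (simp add: h_def nn_integral_cmult)
    then show ?thesis using True by (simp add: ennreal_mult'[symmetric])
  qed (simp add: h_def)
  show ?thesis
    unfolding x_section t_section by (rule lborel_pair.Fubini'[OF meas, symmetric])
qed


section \<open>From the digamma function to the logarithm of the gamma function\<close>

text \<open>By the mean value theorem the quantity is \<open>t\<close> times a value of \<open>Digamma (z + 1) + euler_mascheroni\<close>
  with \<open>0 < z < t\<close>.\<close>

lemma ln_Gamma_plus1_bounds:
  obtains C :: real where "0 \<le> C"
    "\<And>t::real. 0 < t \<Longrightarrow> 0 \<le> ln_Gamma (t + 1) + euler_mascheroni * t"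
    "\<And>t::real. 0 < t \<Longrightarrow> ln_Gamma (t + 1) + euler_mascheroni * t \<le> C * t\<^sup>2"
proof -
  obtain C :: real where C: "0 \<le> C"
    and lo: "\<And>t::real. 0 \<le> t \<Longrightarrow> 0 \<le> Digamma (t + 1) + euler_mascheroni"
    and hi: "\<And>t::real. 0 \<le> t \<Longrightarrow> Digamma (t + 1) + euler_mascheroni \<le> C * t"
    using Digamma_plus1_bounds by blast
  have mvt: "\<exists>z. 0 < z \<and> z < t \<and>
      ln_Gamma (t + 1) + euler_mascheroni * t = t * (Digamma (z + 1) + euler_mascheroni)"
    if t: "0 < t" for t :: real
  proof -
    have "\<exists>z. 0 < z \<and> z < t \<and>
        (ln_Gamma (t + 1) + euler_mascheroni * t) - (ln_Gamma (0 + 1) + euler_mascheroni * 0) =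
        (t - 0) * (Digamma (z + 1) + euler_mascheroni)"
      using t by (intro MVT2) (auto intro!: derivative_eq_intros)
    then show ?thesis by (simp add: ln_Gamma_real_pos)
  qed
  show ?thesis
  proof (rule that[OF C])
    fix t :: real assume t: "0 < t"
    obtain z where z: "0 < z" "z < t"
      and eq: "ln_Gamma (t + 1) + euler_mascheroni * t = t * (Digamma (z + 1) + euler_mascheroni)"
      using mvt[OF t] by blast
    show "0 \<le> ln_Gamma (t + 1) + euler_mascheroni * t"
      unfolding eq using lo[of z] z t by simp
    have "Digamma (z + 1) + euler_mascheroni \<le> C * z" using hi z by simp
    also have "\<dots> \<le> C * t" using C z by (intro mult_left_mono) auto
    finally have "t * (Digamma (z + 1) + euler_mascheroni) \<le> t * (C * t)"
      using t by (intro mult_left_mono) auto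
    then show "ln_Gamma (t + 1) + euler_mascheroni * t \<le> C * t\<^sup>2"
      unfolding eq by (simp add: power2_eq_square mult_ac)
  qed
qed

lemma Laplace_ln_Gamma_absolutely_integrable:
  fixes a :: real
  assumes a: "0 < a"
  shows "(\<lambda>t. exp (- a * t) * ln_Gamma (t + 1)) absolutely_integrable_on {0<..}"
proof -
  obtain C :: real where "0 \<le> C"
    and lo: "\<And>t::real. 0 < t \<Longrightarrow> 0 \<le> ln_Gamma (t + 1) + euler_mascheroni * t"
    and hi: "\<And>t::real. 0 < t \<Longrightarrow> ln_Gamma (t + 1) + euler_mascheroni * t \<le> C * t\<^sup>2"
    using ln_Gamma_plus1_bounds by blast
  show ?thesis
  proof (rule continuous_dominated_absolutely_integrable)
    show "continuous_on {0<..} (\<lambda>t. exp (- a * t) * ln_Gamma (t + 1))"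
      by (intro continuous_intros continuous_at_imp_continuous_on ballI
            DERIV_isCont[where D = "Digamma (_ + 1)"]) (auto intro!: derivative_eq_intros)
    show "(\<lambda>t. C * (t powr (3 - 1) * exp (- a * t)) + euler_mascheroni * (t powr (2 - 1) * exp (- a * t)))
            integrable_on {0<..}"
      by (intro integrable_add integrable_on_mult_right
            has_integral_integrable[OF has_integral_powr_times_exp[OF a]]) auto
    show "\<bar>exp (- a * t) * ln_Gamma (t + 1)\<bar> \<le>
        C * (t powr (3 - 1) * exp (- a * t)) + euler_mascheroni * (t powr (2 - 1) * exp (- a * t))"
      if t: "0 < t" for t
    proof -
      have "0 \<le> euler_mascheroni * t" using t euler_mascheroni_pos by simp
      then have "\<bar>ln_Gamma (t + 1)\<bar> \<le> C * t\<^sup>2 + euler_mascheroni * t"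
        using lo[OF t] hi[OF t] by linarith
      then have "exp (- a * t) * \<bar>ln_Gamma (t + 1)\<bar> \<le> exp (- a * t) * (C * t\<^sup>2 + euler_mascheroni * t)"
        by (intro mult_left_mono) auto
      then show ?thesis using t by (simp add: abs_mult algebra_simps powr_numeral)
    qed
  qed
qed

text \<open>Integration by parts is carried out for \<open>\<Lambda> t = ln_Gamma (t + 1) + euler_mascheroni * t\<close>, whose
  derivative is \<open>Digamma (t + 1) + euler_mascheroni\<close>. It satisfies \<open>0 \<le> \<Lambda> t \<le> D * t\<^sup>2\<close>, so the
  boundary terms vanish at both ends; its linear part contributes \<open>euler_mascheroni / a\<close>.\<close>

lemma Laplace_Digamma_by_parts:
  fixes a :: real
  assumes a: "0 < a"
  shows "((\<lambda>t. exp (- a * t) * (Digamma (t + 1) + euler_mascheroni)) has_integral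
           euler_mascheroni / a + a * integral {0<..} (\<lambda>t. exp (- a * t) * ln_Gamma (t + 1))) {0<..}"
proof -
  define \<Lambda> where "\<Lambda> = (\<lambda>t::real. ln_Gamma (t + 1) + euler_mascheroni * t)"
  define \<psi> where "\<psi> = (\<lambda>t::real. Digamma (t + 1) + euler_mascheroni)"
  define u where "u = (\<lambda>t. exp (- a * t) * ln_Gamma (t + 1))"
  obtain C :: real where C: "0 \<le> C"
    and lo: "\<And>t::real. 0 \<le> t \<Longrightarrow> 0 \<le> Digamma (t + 1) + euler_mascheroni"
    and hi: "\<And>t::real. 0 \<le> t \<Longrightarrow> Digamma (t + 1) + euler_mascheroni \<le> C * t"
    using Digamma_plus1_bounds by blast
  obtain D :: real where "0 \<le> D" and lo': "\<And>t::real. 0 < t \<Longrightarrow> 0 \<le> \<Lambda> t" and hi': "\<And>t::real. 0 < t \<Longrightarrow> \<Lambda> t \<le> D * t\<^sup>2"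
    using ln_Gamma_plus1_bounds unfolding \<Lambda>_def by blast
  have u: "u absolutely_integrable_on {0<..}"
    unfolding u_def by (rule Laplace_ln_Gamma_absolutely_integrable[OF a])
  have lin: "((\<lambda>t. t powr (2 - 1) * exp (- a * t)) has_integral Gamma 2 / a powr 2) {0<..}"
    using has_integral_powr_times_exp[OF a, of 2] by simp
  have lin': "(\<lambda>t. t powr (2 - 1) * exp (- a * t)) absolutely_integrable_on {0<..}"
    using lin by (subst absolutely_integrable_on_iff_nonneg) (auto simp: has_integral_iff)
  have \<psi>_int: "(\<lambda>t. exp (- a * t) * \<psi> t) absolutely_integrable_on {0<..}"
  proof (rule continuous_dominated_absolutely_integrable)
    show "continuous_on {0<..} (\<lambda>t. exp (- a * t) * \<psi> t)"
      unfolding \<psi>_def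
      by (intro continuous_at_imp_continuous_on ballI continuous_intros)
         (auto dest!: nonpos_Ints_nonpos)
    show "(\<lambda>t. C * (t powr (2 - 1) * exp (- a * t))) integrable_on {0<..}"
      using lin by (intro integrable_on_mult_right has_integral_integrable)
    show "\<bar>exp (- a * t) * \<psi> t\<bar> \<le> C * (t powr (2 - 1) * exp (- a * t))" if t: "0 < t" for t
      using lo[of t] hi[of t] t by (simp add: abs_mult \<psi>_def mult_ac)
  qed
  define v where "v = (\<lambda>t. u t + euler_mascheroni * (t powr (2 - 1) * exp (- a * t)))"
  have v: "v absolutely_integrable_on {0<..}"
    unfolding v_def by (intro set_integral_add(1) u set_integrable_mult_right lin')
  have v_int: "(v has_integral integral {0<..} u + euler_mascheroni * (1 / a\<^sup>2)) {0<..}"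
  proof -
    have "(u has_integral integral {0<..} u) {0<..}"
      using set_lebesgue_integral_eq_integral(1)[OF u] by (simp add: has_integral_iff)
    moreover have "((\<lambda>t. t powr (2 - 1) * exp (- a * t)) has_integral 1 / a\<^sup>2) {0<..}"
      using lin a Gamma_numeral[of "num.Bit0 num.One", where ?'a=real] by (simp add: powr_numeral)
    ultimately show ?thesis
      unfolding v_def by (intro has_integral_add has_integral_mult_right)
  qed
  have v_eq: "v t = exp (- a * t) * \<Lambda> t" if "0 < t" for t
    using that by (simp add: v_def u_def \<Lambda>_def algebra_simps)
  \<comment> \<open>One sandwich argument serves both ends of the half line.\<close>
  have lim: "((\<lambda>t. exp (- a * t) * \<Lambda> t) \<longlongrightarrow> 0) F"
    if "((\<lambda>t. exp (- a * t) * (D * t\<^sup>2)) \<longlongrightarrow> 0) F" "\<forall>\<^sub>F t in F. 0 < t" for F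
  proof (rule tendsto_sandwich[OF _ _ tendsto_const that(1)])
    show "\<forall>\<^sub>F t in F. 0 \<le> exp (- a * t) * \<Lambda> t"
      using that(2) by eventually_elim (auto intro!: mult_nonneg_nonneg lo')
    show "\<forall>\<^sub>F t in F. exp (- a * t) * \<Lambda> t \<le> exp (- a * t) * (D * t\<^sup>2)"
      using that(2) by eventually_elim (auto intro!: mult_left_mono hi')
  qed
  have "((\<lambda>t. exp (- a * t) * \<psi> t - a * v t) has_integral 0 - 0) {0<..}"
  proof (rule has_integral_FTC_greaterThan_0)
    show "((\<lambda>t. exp (- a * t) * \<Lambda> t) has_real_derivative exp (- a * t) * \<psi> t - a * v t) (at t)"
      if "0 < t" for t
      unfolding v_eq[OF that] using that unfolding \<Lambda>_def \<psi>_def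
      by (auto intro!: derivative_eq_intros simp: algebra_simps)
    show "(\<lambda>t. exp (- a * t) * \<psi> t - a * v t) absolutely_integrable_on {0<..}"
      by (intro set_integral_diff(1) \<psi>_int set_integrable_mult_right v)
    show "((\<lambda>t. exp (- a * t) * \<Lambda> t) \<longlongrightarrow> 0) (at_right 0)"
      by (rule lim) (auto intro!: tendsto_eq_intros eventually_at_right_less)
    show "((\<lambda>t. exp (- a * t) * \<Lambda> t) \<longlongrightarrow> 0) at_top"
    proof (rule lim)
      have "((\<lambda>t. exp (- a * t) * t\<^sup>2) \<longlongrightarrow> 0) at_top" using a by real_asymp
      from tendsto_mult_right_zero[OF this, of D]
      show "((\<lambda>t. exp (- a * t) * (D * t\<^sup>2)) \<longlongrightarrow> 0) at_top" by (simp add: mult_ac)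
    qed (rule eventually_gt_at_top)
  qed
  from has_integral_add[OF this has_integral_mult_right[OF v_int, of a]]
  have "((\<lambda>t. exp (- a * t) * \<psi> t) has_integral a * (integral {0<..} u + euler_mascheroni * (1 / a\<^sup>2))) {0<..}"
    by simp
  also have "a * (integral {0<..} u + euler_mascheroni * (1 / a\<^sup>2)) = euler_mascheroni / a + a * integral {0<..} u"
    using a by (simp add: field_simps power2_eq_square)
  finally show ?thesis unfolding \<psi>_def u_def .
qed

text \<open>Let \<open>G\<close> be the integral on the left. By \<open>ln (Gamma t) = ln (Gamma (t + 1)) - ln t\<close>, the function
  \<open>f t = e\<^sup>-\<^sup>a\<^sup>t * ln (Gamma t)\<close> has the integral \<open>G + (euler_mascheroni + ln a) / a\<close> over \<open>[0, \<infinity>)\<close>. By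
  translation its integral over \<open>(1, \<infinity>)\<close> is \<open>e\<^sup>-\<^sup>a * G\<close>. The difference of the two is its integral
  over \<open>[0, 1]\<close>.\<close>

lemma Laplace_ln_Gamma_unit_interval:
  fixes a :: real
  assumes a: "0 < a"
  shows "(1 - exp (- a)) * integral {0<..} (\<lambda>t. exp (- a * t) * ln_Gamma (t + 1)) =
           integral {0..1} (\<lambda>t. exp (- a * t) * ln (Gamma t)) - (euler_mascheroni + ln a) / a"
proof -
  define u where "u = (\<lambda>t. exp (- a * t) * ln_Gamma (t + 1))"
  define f where "f = (\<lambda>t. exp (- a * t) * ln (Gamma t))"
  have u: "u absolutely_integrable_on {0<..}"
    unfolding u_def by (rule Laplace_ln_Gamma_absolutely_integrable[OF a])
  then have u_int: "(u has_integral integral {0<..} u) {0<..}"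
    using set_lebesgue_integral_eq_integral(1)[OF u] by (simp add: has_integral_iff)
  have f_eq: "f t = u t - exp (- a * t) * ln t" if "0 < t" for t
  proof -
    have "t \<notin> \<int>\<^sub>\<le>\<^sub>0" using that nonpos_Ints_nonpos[of t] by linarith
    then have "Gamma (t + 1) = t * Gamma t" by (rule Gamma_plus1)
    then have "ln_Gamma (t + 1) = ln t + ln (Gamma t)"
      using that Gamma_real_pos[OF that] ln_mult_pos[of t "Gamma t"]
      by (simp add: ln_Gamma_real_pos)
    then show ?thesis by (simp add: f_def u_def algebra_simps)
  qed
  have "((\<lambda>t. u t - exp (- a * t) * ln t) has_integral integral {0<..} u - - (euler_mascheroni + ln a) / a) {0<..}"
    by (intro has_integral_diff u_int has_integral_ln_times_exp a)
  then have "(f has_integral integral {0<..} u - - (euler_mascheroni + ln a) / a) {0<..}"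
    by (rule has_integral_eq[rotated]) (simp add: f_eq)
  then have "(f has_integral integral {0<..} u + (euler_mascheroni + ln a) / a) {0<..}"
    by (simp only: minus_divide_left[symmetric] diff_minus_eq_add)
  then have f0: "(f has_integral integral {0<..} u + (euler_mascheroni + ln a) / a) {0..}"
    by (subst has_integral_spike_set_eq[where T = "{0<..}"]) (auto intro: negligible_subset[of "{0}"])
  have shift: "\<bar>1\<bar> * f (t + 1) = exp (- a) * u t" if "0 < t" for t
    using that by (simp add: f_def u_def ln_Gamma_real_pos exp_add[symmetric] algebra_simps)
  have "(\<lambda>t. \<bar>1\<bar> * f (t + 1)) absolutely_integrable_on {0<..} \<and>
          integral {0<..} (\<lambda>t. \<bar>1\<bar> * f (t + 1)) = exp (- a) * integral {0<..} u"
  proof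
    have "(\<lambda>t. exp (- a) * u t) absolutely_integrable_on {0<..}"
      using u by (rule set_integrable_mult_right)
    moreover have "(\<lambda>t. \<bar>1\<bar> * f (t + 1)) absolutely_integrable_on {0<..} \<longleftrightarrow>
        (\<lambda>t. exp (- a) * u t) absolutely_integrable_on {0<..}"
      by (rule set_integrable_cong) (use shift in auto)
    ultimately show "(\<lambda>t. \<bar>1\<bar> * f (t + 1)) absolutely_integrable_on {0<..}"
      by blast
    have "((\<lambda>t. \<bar>1\<bar> * f (t + 1)) has_integral exp (- a) * integral {0<..} u) {0<..}"
      using has_integral_mult_right[OF u_int, of "exp (- a)"]
      by (rule has_integral_eq[rotated]) (use shift in auto)
    then show "integral {0<..} (\<lambda>t. \<bar>1\<bar> * f (t + 1)) = exp (- a) * integral {0<..} u"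
      by (rule integral_unique)
  qed
  then have "f absolutely_integrable_on (\<lambda>t. t + 1) ` {0<..} \<and>
      integral ((\<lambda>t. t + 1) ` {0<..}) f = exp (- a) * integral {0<..} u"
    by (subst has_absolute_integral_change_of_variables_1'[symmetric])
       (auto intro!: derivative_eq_intros)
  moreover have "(\<lambda>t::real. t + 1) ` {0<..} = {1<..}"
    by (auto simp: image_iff intro!: bexI[of _ "_ - 1"])
  ultimately have "(f has_integral exp (- a) * integral {0<..} u) {1<..}"
    using set_lebesgue_integral_eq_integral(1)[of "{1<..}" f] by (simp add: has_integral_iff)
  moreover have "f integrable_on {0..1}"
    using f0 by (intro integrable_on_subinterval[of f "{0..}"]) auto
  then have "(f has_integral integral {0..1} f) {0..1}" by (simp add: has_integral_iff)
  moreover have disjoint: "{0..1} \<inter> {1<..} = ({} :: real set)" by auto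
  ultimately have "(f has_integral integral {0..1} f + exp (- a) * integral {0<..} u) ({0..1} \<union> {1<..})"
    by (intro has_integral_Un) (simp_all only: disjoint negligible_empty)
  also have "{0..1} \<union> {1<..} = {0::real..}" by auto
  finally have "integral {0<..} u + (euler_mascheroni + ln a) / a = integral {0..1} f + exp (- a) * integral {0<..} u"
    using f0 by (rule has_integral_unique[rotated])
  then show ?thesis by (simp add: u_def f_def algebra_simps)
qed

lemma unit_interval_log_integral:
  fixes a :: real
  assumes a: "0 < a"
  shows "((\<lambda>u. (1 / a - 1 / (a - ln (1 - u))) / u) has_integral
            euler_mascheroni / a +
            a * integral {0<..} (\<lambda>t. exp (- a * t) * ln_Gamma (t + 1))) {0..1}"
proof -
  define B where "B = euler_mascheroni / a + a * integral {0<..} (\<lambda>t. exp (- a * t) * ln_Gamma (t + 1))"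
  define k where "k = (\<lambda>x. (1 / a - 1 / (a - ln x)) / (1 - x))"
  have k_nonneg: "0 \<le> k x" if "x \<in> {0<..<1}" for x
  proof -
    have "ln x < 0" using that by simp
    then have "1 / (a - ln x) \<le> 1 / a" using a by (intro divide_left_mono) auto
    then show ?thesis using that by (simp add: k_def)
  qed
  have D: "((\<lambda>t. exp (- a * t) * (Digamma (t + 1) + euler_mascheroni)) has_integral B) {0..}"
    using Laplace_Digamma_by_parts[OF a] unfolding B_def
    by (subst has_integral_spike_set_eq[where T = "{0<..}"]) (auto intro: negligible_subset[of "{0}"])
  have D_nonneg: "0 \<le> exp (- a * t) * (Digamma (t + 1) + euler_mascheroni)" if "t \<in> {0..}" for t
    using that Digamma_plus1_bounds by (metis atLeast_iff exp_ge_zero mult_nonneg_nonneg)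
  have B: "0 \<le> B" by (rule has_integral_nonneg[OF D D_nonneg])
  have "(\<integral>\<^sup>+x. ennreal (indicator {0<..<1} x * k x) \<partial>lborel) =
          (\<integral>\<^sup>+x. ennreal (k x) * indicator {0<..<1} x \<partial>lborel)"
    by (intro nn_integral_cong) (simp add: indicator_def)
  also have "\<dots> = ennreal B"
    using nn_integral_Laplace_Digamma[OF a] nn_integral_has_integral_lebesgue'[OF D_nonneg D]
    by (simp add: k_def)
  finally have "has_bochner_integral lborel (\<lambda>x. indicator {0<..<1} x * k x) B"
    using k_nonneg B by (intro has_bochner_integral_nn_integral) (auto simp: k_def indicator_def)
  then have "((\<lambda>x. indicator {0<..<1} x * k x) has_integral B) UNIV"
    using has_integral_integral_real by (auto simp: has_bochner_integral_iff)
  moreover have "(\<lambda>x. indicator {0<..<1} x * k x) = (\<lambda>x. if x \<in> {0<..<1} then k x else 0)"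
    by (auto simp: indicator_def)
  ultimately have "(k has_integral B) {0<..<1}"
    by (simp only: has_integral_restrict_UNIV)
  then have "(k has_integral B) (cbox 0 1)"
    by (simp add: has_integral_Icc_iff_Ioo)
  \<comment> \<open>The reflection \<open>x = 1 - u\<close>.\<close>
  from has_integral_affinity[OF this, of "-1" 1]
  have "((\<lambda>u. k (1 - u)) has_integral B) ((\<lambda>x. 1 - x) ` {0..1})"
    by simp
  moreover have "(\<lambda>x. 1 - x) ` {0..1::real} = {0..1}" by simp
  ultimately show ?thesis by (simp add: k_def B_def)
qed

theorem theorem2p1:
  fixes a :: real
  assumes "0 < a" and "a < ln 2"
  shows "M a = euler_mascheroni / a
           + (a + ln (1 - exp (- a)) - euler_mascheroni - ln a) / (1 - exp (- a))
           + a / (1 - exp (- a)) * integral {0..1} (\<lambda>t. exp (- a * t) * ln (Gamma t))"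
proof -
  define G where "G = integral {0<..} (\<lambda>t. exp (- a * t) * ln_Gamma (t + 1))"
  define I where "I = integral {0..1} (\<lambda>t. exp (- a * t) * ln (Gamma t))"
  define d where "d = 1 - exp (- a)"
  have d: "d \<noteq> 0" using assms by (simp add: d_def)
  have "d * G = I - (euler_mascheroni + ln a) / a"
    unfolding G_def I_def d_def using assms(1) by (rule Laplace_ln_Gamma_unit_interval)
  then have "G = (I - (euler_mascheroni + ln a) / a) / d"
    using d by (simp add: eq_divide_eq mult.commute)
  then have "a * G = (a * I - (euler_mascheroni + ln a)) / d"
    using assms(1) by (simp add: right_diff_distrib)
  moreover have "M a = euler_mascheroni / a + a * G + (a + ln d) / d"
    unfolding G_def d_def
    by (rule M_eq_unit_interval_integral[OF assms unit_interval_log_integral[OF assms(1)]])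
  ultimately have "M a = euler_mascheroni / a + (a + ln d - euler_mascheroni - ln a) / d + a / d * I"
    by (simp add: diff_divide_distrib add_divide_distrib)
  then show ?thesis by (simp only: d_def I_def)
qed

end
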